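(* Let $\nu\in\mathbb R$. The set of $j_\nu$-Liouville numbers, as a subset of $\mathbb R$, has Lebesgue measure zero.
   Context: The normalized Bessel function of order $\nu$ is the even entire function $j_\nu(z)=\sum_{k=0}^\infty \frac{(-1)^k}{k!\,\Gamma(k+\nu+1)}(z/2)^{2k}$, with $1/\Gamma=0$ at nonpositive integers (equal to $(z/2)^{-\nu}J_\nu(z)$). A nonzero complex number $z$ is $j_\nu$-rational if $z=a/b$ with $a,b$ zeros of $j_\nu$ in $\mathbb C$ and $b\ne0$. A complex number $z$ is $j_\nu$-Liouville if (i) $z$ is not $j_\nu$-rational, and (ii) for every $N\in\mathbb N$ there are zeros $a,b$ of $j_\nu$ with $|b|>1$ such that $|z-a/b|<1/|b|^N$. All $j_\nu$-Liouville numbers are real. *)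

theory Defs
  imports "HOL-Analysis.Analysis"
begin

text \<open>
  The normalized Bessel function $j_\nu(z) = (z/2)^{-\nu} J_\nu(z)$. The library function
  \<^const>\<open>rGamma\<close> is the reciprocal Gamma function, with value \<open>0\<close> at the nonpositive integers.
\<close>

definition bessel_j :: "real \<Rightarrow> complex \<Rightarrow> complex" where
  "bessel_j \<nu> z =
     (\<Sum>k. (-1) ^ k / fact k * complex_of_real (rGamma (real k + \<nu> + 1)) * (z / 2) ^ (2 * k))"

definition bessel_zeros :: "real \<Rightarrow> complex set" where
  "bessel_zeros \<nu> = {z. bessel_j \<nu> z = 0}"

text \<open>
  Only nonzero numbers can be rational in this sense, even when \<open>0\<close> is itself a zero
  of \<^term>\<open>bessel_j \<nu>\<close> (i.e. when \<open>\<nu>\<close> is a negative integer).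
\<close>

definition bessel_rational :: "real \<Rightarrow> complex \<Rightarrow> bool" where
  "bessel_rational \<nu> z \<longleftrightarrow>
     z \<noteq> 0 \<and> (\<exists>a\<in>bessel_zeros \<nu>. \<exists>b\<in>bessel_zeros \<nu>. b \<noteq> 0 \<and> z = a / b)"

definition bessel_Liouville :: "real \<Rightarrow> complex \<Rightarrow> bool" where
  "bessel_Liouville \<nu> z \<longleftrightarrow>
     \<not> bessel_rational \<nu> z \<and>
     (\<forall>N::nat. \<exists>a\<in>bessel_zeros \<nu>. \<exists>b\<in>bessel_zeros \<nu>.
        norm b > 1 \<and> norm (z - a / b) < 1 / norm b ^ N)"

end

theory Submission
  imports Defs "HOL-Complex_Analysis.Complex_Analysis"
begin

text \<open>
  The function $j_\nu$ is entire of finite order and not identically zero, so the number of its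
  zeros of modulus at most $R$ is bounded by a polynomial in $R$: dividing out $n$ zeros in a disc
  of radius $R$ around a point $z_0$ and applying the maximum principle on the circle of radius
  $3R$ gives $2^n |j_\nu(z_0)| \le \max |j_\nu|$. Hence the intervals of radius
  $|b|^{-N}$ around the quotients $a/b$ with $n \le |b| < n+1$ and $|a| \le n|b|$ have, for a
  suitable fixed $N$, total length $O(n^{-2})$, and Borel--Cantelli applies. A number lying in such
  intervals for only finitely many $n$ is approximated to all orders by finitely many quotients,
  hence equal to one of them.
\<close>

section \<open>Counting zeros of entire functions of finite order\<close>

text \<open>Induction over the distinct zeros: the linear factors already split off do not vanish at
  the new point \<open>b\<close>, so the cofactor \<open>g\<close> does, and its difference
  quotient, completed at \<open>b\<close> by the derivative, is again entire.\<close>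

lemma entire_factor_out_zeros:
  assumes "finite F" "f holomorphic_on UNIV" "\<And>a. a \<in> F \<Longrightarrow> f a = 0"
  shows "\<exists>g. g holomorphic_on UNIV \<and> (\<forall>z::complex. f z = (\<Prod>a\<in>F. (z - a)) * g z)"
  using assms(1,3)
proof (induction F)
  case empty
  then show ?case using assms(2) by auto
next
  case (insert b F)
  then obtain g where g: "g holomorphic_on UNIV" "\<And>z. f z = (\<Prod>a\<in>F. (z - a)) * g z"
    by auto
  have "(\<Prod>a\<in>F. (b - a)) \<noteq> 0"
    using insert by auto
  then have gb: "g b = 0"
    using g(2)[of b] insert.prems[of b] by auto
  define h where "h = (\<lambda>z. if z = b then deriv g b else (g z - g b) / (z - b))"
  have "h holomorphic_on UNIV"
    unfolding h_def using g(1) by (rule pole_lemma_open) auto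
  moreover have "g z = (z - b) * h z" for z
    by (simp add: h_def gb)
  then have "f z = (\<Prod>a\<in>insert b F. (z - a)) * h z" for z
    using insert.hyps g(2)[of z] by (simp add: mult_ac)
  ultimately show ?case by blast
qed

text \<open>A substitute for Jensen's formula. On the sphere of radius \<open>3 * R\<close> every
  factor \<open>z - a\<close> has modulus at least \<open>2 * R\<close>, whereas at the centre it
  has modulus at most \<open>R\<close>; after the maximum principle for the cofactor, each zero
  contributes a factor 2.\<close>

lemma card_zeros_le_of_bound:
  fixes f :: "complex \<Rightarrow> complex"
  assumes f: "f holomorphic_on UNIV" and "R > 0"
    and F: "finite F" "F \<subseteq> cball c R" "\<And>a. a \<in> F \<Longrightarrow> f a = 0"
    and M: "\<And>z. z \<in> sphere c (3 * R) \<Longrightarrow> norm (f z) \<le> M"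
  shows "2 ^ card F * norm (f c) \<le> M"
proof -
  obtain g where g: "g holomorphic_on UNIV" "\<And>z. f z = (\<Prod>a\<in>F. (z - a)) * g z"
    using entire_factor_out_zeros[OF F(1) f F(3)] by blast
  define n where "n = card F"
  have "norm (g c) \<le> M / (2 * R) ^ n"
  proof (rule maximum_modulus_frontier[where S = "cball c (3 * R)" and f = g and \<xi> = c])
    show "g holomorphic_on interior (cball c (3 * R))"
      using g(1) by (rule holomorphic_on_subset) auto
    show "continuous_on (closure (cball c (3 * R))) g"
      by (intro holomorphic_on_imp_continuous_on holomorphic_on_subset[OF g(1)]) auto
  next
    fix z assume "z \<in> frontier (cball c (3 * R))"
    then have z: "z \<in> sphere c (3 * R)"
      by simp
    have "(2 * R) ^ n = (\<Prod>a\<in>F. 2 * R)"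
      by (simp add: n_def)
    also have "\<dots> \<le> (\<Prod>a\<in>F. norm (z - a))"
    proof (rule prod_mono)
      fix a assume "a \<in> F"
      then have "dist c a \<le> R" using F(2) by auto
      moreover have "dist c z = 3 * R" using z by simp
      ultimately have "2 * R \<le> dist z a"
        using dist_triangle[of c z a] by (simp add: dist_commute)
      then show "0 \<le> 2 * R \<and> 2 * R \<le> norm (z - a)"
        using \<open>R > 0\<close> by (simp add: dist_norm)
    qed
    finally have "(2 * R) ^ n * norm (g z) \<le> (\<Prod>a\<in>F. norm (z - a)) * norm (g z)"
      by (intro mult_right_mono) auto
    also have "\<dots> = norm (f z)"
      by (simp add: g(2) norm_mult flip: prod_norm)
    also have "\<dots> \<le> M" using M z by blast
    finally show "norm (g z) \<le> M / (2 * R) ^ n"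
      using \<open>R > 0\<close> by (simp add: field_simps)
  qed (use \<open>R > 0\<close> in auto)
  moreover have "norm (f c) \<le> R ^ n * norm (g c)"
  proof -
    have "(\<Prod>a\<in>F. norm (c - a)) \<le> (\<Prod>a\<in>F. R)"
      using F(2) by (intro prod_mono) (auto simp: dist_norm)
    then show ?thesis
      by (auto simp: g(2) norm_mult n_def intro!: mult_right_mono simp flip: prod_norm)
  qed
  ultimately have "norm (f c) \<le> R ^ n * (M / (2 * R) ^ n)"
    using \<open>R > 0\<close> by (meson mult_left_mono order_trans zero_le_power less_imp_le)
  then show ?thesis
    using \<open>R > 0\<close> by (simp add: n_def power_mult_distrib field_simps)
qed

lemma finite_order_zeros_polynomial_count:
  fixes f :: "complex \<Rightarrow> complex"
  assumes f: "f holomorphic_on UNIV" "f c \<noteq> 0" and "A \<ge> 0"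
    and growth: "\<And>z. norm (f z) \<le> B * exp (A * norm z ^ p)"
  obtains C where "\<And>R. R \<ge> 1 \<Longrightarrow> finite {z. f z = 0 \<and> norm z \<le> R} \<and>
      real (card {z. f z = 0 \<and> norm z \<le> R}) \<le> C * R ^ p"
proof -
  \<comment> \<open>The disc of radius \<open>R\<close> about 0 lies in the disc of radius
    \<open>R + norm c\<close> about \<open>c\<close>. Tripling the latter radius reaches points of
    modulus at most \<open>3 * R + 4 * norm c\<close>, which is at most \<open>D * R\<close> because
    \<open>R \<ge> 1\<close>.\<close>
  define D where "D = 3 + 4 * norm c"
  \<comment> \<open>The logarithm may be negative, so its absolute value is taken;
    \<open>R ^ p \<ge> 1\<close> then absorbs it into the multiple of \<open>R ^ p\<close>.\<close>
  define K where "K = \<bar>ln (B / norm (f c))\<bar> + A * D ^ p"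
  have "0 < norm (f c)" using f(2) by simp
  also have "\<dots> \<le> B * exp (A * norm c ^ p)" by (rule growth)
  finally have B: "B > 0" by (simp add: zero_less_mult_iff)
  \<comment> \<open>Formulated for finite sets of zeros, because finiteness of the whole zero set in
    a disc is itself deduced from this uniform bound.\<close>
  have bound: "real (card F) \<le> (K / ln 2) * R ^ p"
    if "R \<ge> 1" and F: "F \<subseteq> {z. f z = 0 \<and> norm z \<le> R}" "finite F" for R F
  proof -
    have "2 ^ card F * norm (f c) \<le> B * exp (A * (D * R) ^ p)"
    proof (rule card_zeros_le_of_bound[OF f(1)])
      show "0 < R + norm c" using \<open>R \<ge> 1\<close> by (simp add: add_pos_nonneg)
      show "F \<subseteq> cball c (R + norm c)"
      proof
        fix a assume "a \<in> F"
        then have "norm a \<le> R" using F by auto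
        then show "a \<in> cball c (R + norm c)"
          using norm_triangle_ineq4[of c a] by (simp add: dist_norm)
      qed
      fix z assume "z \<in> sphere c (3 * (R + norm c))"
      then have "norm (z - c) = 3 * (R + norm c)" by (simp add: dist_norm norm_minus_commute)
      then have "norm z \<le> 3 * R + 4 * norm c"
        using norm_triangle_ineq[of "z - c" c] by simp
      also have "\<dots> \<le> D * R"
        using mult_left_mono[OF \<open>R \<ge> 1\<close>, of "4 * norm c"] by (simp add: D_def algebra_simps)
      finally have "norm z ^ p \<le> (D * R) ^ p" by (intro power_mono) auto
      then have "B * exp (A * norm z ^ p) \<le> B * exp (A * (D * R) ^ p)"
        using B \<open>A \<ge> 0\<close> by (simp add: mult_left_mono)
      then show "norm (f z) \<le> B * exp (A * (D * R) ^ p)"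
        using growth[of z] by linarith
    qed (use F in auto)
    then have "2 ^ card F \<le> (B / norm (f c)) * exp (A * (D * R) ^ p)"
      using f(2) by (simp add: field_simps)
    then have "ln (2 ^ card F) \<le> ln ((B / norm (f c)) * exp (A * (D * R) ^ p))"
      using B f(2) by (subst ln_le_cancel_iff) auto
    also have "\<dots> = ln (B / norm (f c)) + A * (D * R) ^ p"
      using B f(2) by (subst ln_mult) auto
    finally have "real (card F) * ln 2 \<le> ln (B / norm (f c)) + A * D ^ p * R ^ p"
      by (simp add: ln_realpow power_mult_distrib)
    also have "ln (B / norm (f c)) \<le> \<bar>ln (B / norm (f c))\<bar> * R ^ p"
    proof -
      have "1 \<le> R ^ p" using \<open>R \<ge> 1\<close> by simp
      then have "\<bar>ln (B / norm (f c))\<bar> * 1 \<le> \<bar>ln (B / norm (f c))\<bar> * R ^ p"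
        by (intro mult_left_mono) auto
      then show ?thesis by linarith
    qed
    finally have "real (card F) * ln 2 \<le> K * R ^ p"
      by (simp add: K_def algebra_simps)
    then show ?thesis by (simp add: field_simps)
  qed
  show thesis
  proof (rule that)
    fix R :: real assume R: "R \<ge> 1"
    have "finite {z. f z = 0 \<and> norm z \<le> R}"
    proof (rule finite_if_finite_subsets_card_bdd[THEN conjunct1])
      fix F assume "F \<subseteq> {z. f z = 0 \<and> norm z \<le> R}" "finite F"
      then show "card F \<le> nat \<lfloor>(K / ln 2) * R ^ p\<rfloor>"
        using bound[OF R, of F] by (simp add: le_nat_floor)
    qed
    then show "finite {z. f z = 0 \<and> norm z \<le> R} \<and>
        real (card {z. f z = 0 \<and> norm z \<le> R}) \<le> (K / ln 2) * R ^ p"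
      using bound[OF R] by blast
  qed
qed

section \<open>The normalized Bessel function\<close>

text \<open>By the functional equation, \<open>x * rGamma (x + 1) = rGamma x\<close>, so the modulus
  does not increase under unit steps once \<open>x \<ge> 1\<close>. The index \<open>m\<close> marks
  where this starts, and a finite sum bounds the terms up to \<open>m\<close>.\<close>

lemma rGamma_shift_bounded:
  fixes s :: real
  obtains B where "\<And>k. \<bar>rGamma (real k + s)\<bar> \<le> B"
proof -
  define m where "m = nat \<lceil>1 - s\<rceil>"
  have tail: "\<bar>rGamma (real (m + k) + s)\<bar> \<le> \<bar>rGamma (real m + s)\<bar>" for k
  proof (induction k)
    case (Suc k)
    define x where "x = real (m + k) + s"
    have "1 \<le> x" unfolding x_def m_def by linarith
    have "\<bar>rGamma (x + 1)\<bar> \<le> \<bar>x\<bar> * \<bar>rGamma (x + 1)\<bar>"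
      using \<open>1 \<le> x\<close> by (simp add: mult_le_cancel_right1)
    also have "\<dots> = \<bar>rGamma x\<bar>"
      by (simp flip: abs_mult add: rGamma_plus1)
    finally show ?case using Suc by (simp add: x_def add_ac)
  qed simp
  define B where "B = (\<Sum>k\<le>m. \<bar>rGamma (real k + s)\<bar>)"
  have small: "\<bar>rGamma (real k + s)\<bar> \<le> B" if "k \<le> m" for k
    unfolding B_def using that by (intro member_le_sum) auto
  show thesis
  proof (rule that)
    fix k
    show "\<bar>rGamma (real k + s)\<bar> \<le> B"
    proof (cases "k \<le> m")
      case False
      then have "\<bar>rGamma (real k + s)\<bar> \<le> \<bar>rGamma (real m + s)\<bar>"
        using tail[of "k - m"] by simp
      then show ?thesis using small[of m] by simp
    qed (rule small)
  qed
qed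

text \<open>Coefficients with respect to the variable \<open>w = (z / 2) ^ 2\<close>, which turns
  the even series into an ordinary power series.\<close>

definition bessel_coeff :: "real \<Rightarrow> nat \<Rightarrow> complex" where
  "bessel_coeff \<nu> k = (-1) ^ k / fact k * complex_of_real (rGamma (real k + \<nu> + 1))"

lemma bessel_j_eq_powser: "bessel_j \<nu> z = (\<Sum>k. bessel_coeff \<nu> k * ((z / 2) ^ 2) ^ k)"
  by (simp add: bessel_j_def bessel_coeff_def flip: power_mult)

text \<open>Domination by the exponential series yields both convergence everywhere and the growth
  estimate.\<close>

lemma bessel_coeff_bound:
  obtains B where "\<And>k w. norm (bessel_coeff \<nu> k * w ^ k) \<le> B * (norm w ^ k / fact k)"
proof -
  obtain B where B: "\<And>k. \<bar>rGamma (real k + (\<nu> + 1))\<bar> \<le> B"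
    using rGamma_shift_bounded[of "\<nu> + 1"] by blast
  have "norm (bessel_coeff \<nu> k * w ^ k) \<le> B * (norm w ^ k / fact k)" for k w
  proof -
    have "norm (bessel_coeff \<nu> k * w ^ k)
        = \<bar>rGamma (real k + (\<nu> + 1))\<bar> * (norm w ^ k / fact k)"
      by (simp add: bessel_coeff_def norm_mult norm_divide norm_power add.assoc)
    also have "\<dots> \<le> B * (norm w ^ k / fact k)"
      by (intro mult_right_mono B) auto
    finally show ?thesis .
  qed
  then show thesis using that by blast
qed

lemma summable_exp_series: "summable (\<lambda>k. B * (x ^ k / fact k :: real))"
  using summable_exp[of x] by (intro summable_mult) (simp add: field_simps)

lemma bessel_coeff_summable: "summable (\<lambda>k. bessel_coeff \<nu> k * w ^ k)"
proof -
  obtain B where "\<And>k w. norm (bessel_coeff \<nu> k * w ^ k) \<le> B * (norm w ^ k / fact k)"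
    using bessel_coeff_bound by blast
  then show ?thesis
    by (rule summable_comparison_test'[OF summable_exp_series])
qed

lemma bessel_j_holomorphic: "bessel_j \<nu> holomorphic_on UNIV"
proof -
  have "(\<lambda>w. \<Sum>k. bessel_coeff \<nu> k * w ^ k) holomorphic_on UNIV"
    using termdiffs_strong_converges_everywhere[OF bessel_coeff_summable]
    by (meson holomorphic_onI field_differentiable_at_within field_differentiable_def)
  then have "((\<lambda>w. \<Sum>k. bessel_coeff \<nu> k * w ^ k) \<circ> (\<lambda>z. (z / 2) ^ 2)) holomorphic_on UNIV"
    by (rule holomorphic_on_compose_gen[rotated]) (auto intro!: holomorphic_intros)
  then show ?thesis
    by (simp add: o_def bessel_j_eq_powser[abs_def])
qed

text \<open>Treating the reciprocal Gamma factor as merely bounded costs precision: the exponent is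
  2, although the true order is at most 1. Any fixed exponent gives a polynomial zero count.\<close>

lemma bessel_j_growth:
  obtains B where "\<And>z. norm (bessel_j \<nu> z) \<le> B * exp (norm z ^ 2 / 4)"
proof -
  obtain B where B: "\<And>k w. norm (bessel_coeff \<nu> k * w ^ k) \<le> B * (norm w ^ k / fact k)"
    using bessel_coeff_bound by blast
  have "norm (bessel_j \<nu> z) \<le> B * exp (norm z ^ 2 / 4)" for z
  proof -
    have "norm (bessel_j \<nu> z) \<le> (\<Sum>k. B * (norm ((z / 2) ^ 2) ^ k / fact k))"
      unfolding bessel_j_eq_powser by (intro norm_suminf_le B summable_exp_series)
    also have "\<dots> = B * exp (norm ((z / 2) ^ 2))"
      using summable_exp_series[of 1 "norm ((z / 2) ^ 2)"]
      by (subst suminf_mult) (auto simp: exp_def field_simps)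
    finally show ?thesis
      by (simp add: norm_power norm_divide power_divide)
  qed
  then show thesis using that by blast
qed

lemma bessel_j_not_identically_zero: "\<exists>z. bessel_j \<nu> z \<noteq> 0"
proof (rule ccontr)
  assume "\<not> ?thesis"
  then have zero: "bessel_j \<nu> z = 0" for z by blast
  \<comment> \<open>For negative integers \<open>\<nu>\<close> the first coefficients vanish, so an
    index is taken where the argument of Gamma is positive. The successor also ensures
    \<open>m > 0\<close>, as \<open>powser_0_nonzero\<close> requires.\<close>
  define m where "m = Suc (nat \<lceil>\<bar>\<nu>\<bar>\<rceil>)"
  have "real m + \<nu> + 1 > 0"
    unfolding m_def by linarith
  then have "bessel_coeff \<nu> m \<noteq> 0"
    using Gamma_real_pos[of "real m + \<nu> + 1"]
    by (simp add: bessel_coeff_def rGamma_inverse_Gamma del: Gamma_real_pos)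
  \<comment> \<open>The point \<open>2 * csqrt w\<close> is a preimage of \<open>w\<close> under
    \<open>z \<mapsto> (z / 2) ^ 2\<close>, so the series vanishes at every
    \<open>w\<close>.\<close>
  moreover have "(\<lambda>k. bessel_coeff \<nu> k * (w - 0) ^ k) sums 0" for w
    using bessel_coeff_summable[of \<nu> w] bessel_j_eq_powser[of \<nu> "2 * csqrt w"] zero
    by (simp add: sums_iff)
  ultimately obtain s where "0 < s" "\<And>z. z \<in> cball (0::complex) s - {0} \<Longrightarrow> (0::complex) \<noteq> 0"
    using powser_0_nonzero[of 1 0 "bessel_coeff \<nu>" "\<lambda>_. 0" m] by (auto simp: m_def)
  then show False
    by (metis Diff_iff mem_cball_0 norm_of_real abs_of_pos order_refl singletonD of_real_eq_0_iff less_irrefl)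
qed

lemma bessel_zeros_polynomial_count:
  obtains C where "\<And>R. R \<ge> 1 \<Longrightarrow> finite {z \<in> bessel_zeros \<nu>. norm z \<le> R} \<and>
      real (card {z \<in> bessel_zeros \<nu>. norm z \<le> R}) \<le> C * R ^ 2"
proof -
  obtain B where B: "\<And>z. norm (bessel_j \<nu> z) \<le> B * exp (1 / 4 * norm z ^ 2)"
    using bessel_j_growth[of \<nu>] by auto
  obtain c where c: "bessel_j \<nu> c \<noteq> 0"
    using bessel_j_not_identically_zero by blast
  show thesis
    using finite_order_zeros_polynomial_count[OF bessel_j_holomorphic c _ B] that
    by (simp add: bessel_zeros_def) blast
qed

section \<open>Liouville-type approximation by quotients\<close>

lemma null_set_Liouville_quotients:
  fixes Z :: "complex set"
  assumes count: "\<And>R. R \<ge> 1 \<Longrightarrow> finite {z \<in> Z. norm z \<le> R} \<and>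
      real (card {z \<in> Z. norm z \<le> R}) \<le> C * R ^ p"
  shows "{x::real. (\<forall>a\<in>Z. \<forall>b\<in>Z. complex_of_real x \<noteq> a / b) \<and>
      (\<forall>N::nat. \<exists>a\<in>Z. \<exists>b\<in>Z. norm b > 1 \<and> norm (complex_of_real x - a / b) < 1 / norm b ^ N)}
    \<in> null_sets lebesgue" (is "?L \<in> _")
proof -
  define Zle where "Zle = (\<lambda>R::real. {z \<in> Z. norm z \<le> R})"
  \<comment> \<open>There are O(n^(2p)) choices of \<open>a\<close> and O(n^p) of \<open>b\<close>
    in \<open>P n\<close>; the extra 2 leaves a summable total length O(n^(-2)).\<close>
  define N where "N = 3 * p + 2"
  \<comment> \<open>Only upper bounds on the moduli are imposed, so \<open>P n\<close> contains all
    pairs with |b| in [n, n+1) and |a| at most n|b|. In \<open>W\<close>, all intervals of index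
    \<open>n\<close> share one radius, and taking real parts moves the centres to the real line
    without increasing the distance to a real number.\<close>
  define P where "P = (\<lambda>n::nat. Zle (real n * (real n + 1)) \<times> Zle (real n + 1))"
  define W where "W = (\<lambda>n. \<Union>(a, b)\<in>P n. ball (Re (a / b)) (1 / real n ^ N))"
  have fin: "finite (Zle R)" if "R \<ge> 1" for R
    using count[OF that] by (simp add: Zle_def)
  have finP: "finite (P n)" if "n \<ge> 1" for n
  proof -
    have "1 * 1 \<le> real n * (real n + 1)" using that by (intro mult_mono) auto
    then show ?thesis unfolding P_def using that by (intro finite_cartesian_product fin) auto
  qed
  have C: "C \<ge> 0" using count[of 1] by simp
  have measW: "W n \<in> sets lebesgue" for n
  proof -
    have "open (W n)"
      unfolding W_def case_prod_beta by (intro open_UN ballI open_ball)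
    then show ?thesis by (intro sets_completionI_sets) simp
  qed
  have cardP: "real (card (P n)) \<le> C\<^sup>2 * 4 ^ p * real n ^ (3 * p)" if "n \<ge> 1" for n
  proof -
    have n: "real n \<ge> 1" using that by simp
    have 1: "1 * 1 \<le> real n * (real n + 1)" using n by (intro mult_mono) auto
    have "real (card (Zle (real n * (real n + 1)))) \<le> C * (real n * (real n + 1)) ^ p"
      using count[of "real n * (real n + 1)"] 1 by (simp add: Zle_def)
    also have "\<dots> \<le> C * (real n * (2 * real n)) ^ p"
      using n C by (intro mult_left_mono power_mono) auto
    finally have c1: "real (card (Zle (real n * (real n + 1)))) \<le> C * (real n * (2 * real n)) ^ p" .
    have "real (card (Zle (real n + 1))) \<le> C * (real n + 1) ^ p"
      using count[of "real n + 1"] n by (simp add: Zle_def)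
    also have "\<dots> \<le> C * (2 * real n) ^ p"
      using n C by (intro mult_left_mono power_mono) auto
    finally have c2: "real (card (Zle (real n + 1))) \<le> C * (2 * real n) ^ p" .
    have "real (card (P n)) \<le> (C * (real n * (2 * real n)) ^ p) * (C * (2 * real n) ^ p)"
      unfolding P_def card_cartesian_product of_nat_mult
      using C by (intro mult_mono c1 c2) auto
    also have "\<dots> = C\<^sup>2 * (2 ^ p * 2 ^ p) * (real n ^ p) ^ 3"
      by (simp add: power_mult_distrib power2_eq_square power3_eq_cube)
    also have "\<dots> = C\<^sup>2 * 4 ^ p * real n ^ (3 * p)"
      by (simp flip: power_mult power_mult_distrib add: mult.commute)
    finally show ?thesis .
  qed
  have emW: "emeasure lebesgue (W n) < \<infinity>
      \<and> measure lebesgue (W n) \<le> 2 * C\<^sup>2 * 4 ^ p * (1 / real n ^ 2)" if "n \<ge> 1" for n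
  proof -
    have ball: "emeasure lebesgue (ball x r) = ennreal (2 * r)" if "r \<ge> 0" for x r :: real
      using that by (simp add: ball_eq_greaterThanLessThan)
    have "emeasure lebesgue (W n) \<le> (\<Sum>q\<in>P n. emeasure lebesgue (ball (Re (fst q / snd q)) (1 / real n ^ N)))"
      unfolding W_def case_prod_beta using finP[OF that]
      by (intro emeasure_subadditive_finite) auto
    also have "\<dots> = (\<Sum>q\<in>P n. ennreal (2 * (1 / real n ^ N)))"
      by (intro sum.cong ball) auto
    also have "\<dots> = ennreal (\<Sum>q\<in>P n. 2 * (1 / real n ^ N))"
      by (intro sum_ennreal) auto
    also have "\<dots> \<le> ennreal (C\<^sup>2 * 4 ^ p * real n ^ (3 * p) * (2 * (1 / real n ^ N)))"
      unfolding sum_constant by (intro ennreal_leI mult_right_mono cardP that) auto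
    also have "C\<^sup>2 * 4 ^ p * real n ^ (3 * p) * (2 * (1 / real n ^ N)) = 2 * C\<^sup>2 * 4 ^ p * (1 / real n ^ 2)"
      using that by (simp add: N_def power_add power2_eq_square)
    finally have "emeasure lebesgue (W n) \<le> ennreal (2 * C\<^sup>2 * 4 ^ p * (1 / real n ^ 2))" .
    then show ?thesis
      by (auto simp: measure_def intro: order.strict_trans1 enn2real_leI)
  qed
  \<comment> \<open>The index is shifted because the measure bound is available only from
    \<open>n = 1\<close> on.\<close>
  have "limsup (\<lambda>n. W (Suc n)) \<in> null_sets lebesgue"
  proof (rule borel_cantelli_limsup1)
    have "summable (\<lambda>n. 1 / real (Suc n) ^ 2)"
      using inverse_power_summable[of 2, where 'a = real]
      by (subst summable_Suc_iff[where f = "\<lambda>n. 1 / real n ^ 2"]) (simp add: field_simps)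
    then have "summable (\<lambda>n. 2 * C\<^sup>2 * 4 ^ p * (1 / real (Suc n) ^ 2))"
      by (rule summable_mult)
    then show "summable (\<lambda>n. measure lebesgue (W (Suc n)))"
      by (rule summable_comparison_test'[where N = 0])
        (metis emW One_nat_def Suc_le_mono zero_le real_norm_def abs_of_nonneg measure_nonneg)
  qed (use emW[of "Suc _"] measW in \<open>simp_all\<close>)
  moreover have "?L \<subseteq> limsup (\<lambda>n. W (Suc n))"
  proof
    fix x assume "x \<in> ?L"
    then have irr: "\<And>a b. a \<in> Z \<Longrightarrow> b \<in> Z \<Longrightarrow> complex_of_real x \<noteq> a / b"
      and app: "\<And>N. \<exists>a\<in>Z. \<exists>b\<in>Z. norm b > 1 \<and> norm (complex_of_real x - a / b) < 1 / norm b ^ N"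
      by blast+
    have "\<exists>k\<ge>m. x \<in> W k" for m
    proof (rule ccontr)
      assume contra: "\<not> ?thesis"
      \<comment> \<open>Beyond \<open>n0\<close> an approximating denominator would put
        \<open>x\<close> into some \<open>W n\<close> with \<open>n \<ge> m\<close>. All other
        candidate pairs lie in the finite set \<open>Q\<close>, each at positive distance from
        \<open>x\<close>, and a large exponent \<open>M\<close> rules them out.\<close>
      define n0 where "n0 = m + nat \<lceil>\<bar>x\<bar> + 1\<rceil>"
      have n0: "\<bar>x\<bar> + 1 \<le> real n0" unfolding n0_def by linarith
      define Q where "Q = Zle ((\<bar>x\<bar> + 1) * real n0) \<times> {b \<in> Zle (real n0). norm b > 1}"
      have "1 * 1 \<le> (\<bar>x\<bar> + 1) * real n0"
        using n0 by (intro mult_mono) auto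
      then have "finite Q"
        unfolding Q_def using n0 by (intro finite_cartesian_product finite_Collect_conjI fin disjI1)
          (auto simp: fin)
      moreover have "\<forall>\<^sub>F M in sequentially. 1 / norm (snd q) ^ M < norm (complex_of_real x - fst q / snd q)"
        if "q \<in> Q" for q
      proof -
        have "(\<lambda>M. (1 / norm (snd q)) ^ M) \<longlonglongrightarrow> 0"
          using that by (intro LIMSEQ_realpow_zero) (auto simp: Q_def divide_less_eq)
        moreover have "0 < norm (complex_of_real x - fst q / snd q)"
          using irr[of "fst q" "snd q"] that by (auto simp: Q_def Zle_def)
        ultimately show ?thesis
          unfolding power_one_over by (rule order_tendstoD(2))
      qed
      ultimately have "\<forall>\<^sub>F M in sequentially. \<forall>q\<in>Q. 1 / norm (snd q) ^ M < norm (complex_of_real x - fst q / snd q)"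
        by (intro eventually_ball_finite) auto
      then obtain M where M: "N \<le> M" "\<And>q. q \<in> Q \<Longrightarrow> 1 / norm (snd q) ^ M < norm (complex_of_real x - fst q / snd q)"
        unfolding eventually_sequentially by (meson nat_le_linear order_refl)
      obtain a b where ab: "a \<in> Z" "b \<in> Z" "norm b > 1"
          "norm (complex_of_real x - a / b) < 1 / norm b ^ M"
        using app by blast
      then have "b \<noteq> 0" by auto
      have "1 / norm b ^ M \<le> 1 / norm b ^ N"
        using ab(3) M(1) \<open>b \<noteq> 0\<close> by (intro divide_left_mono power_increasing) auto
      then have close: "norm (complex_of_real x - a / b) < 1 / norm b ^ N"
        using ab(4) by linarith
      have "1 / norm b ^ N \<le> 1"
        using ab(3) \<open>b \<noteq> 0\<close> one_le_power[of "norm b" N] by (simp add: divide_simps)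
      then have "norm (a / b) \<le> \<bar>x\<bar> + 1"
        using close norm_triangle_ineq3[of "complex_of_real x" "a / b"] by auto
      then have a: "norm a \<le> (\<bar>x\<bar> + 1) * norm b"
        using \<open>b \<noteq> 0\<close> by (simp add: norm_divide divide_simps)
      define n where "n = nat \<lfloor>norm b\<rfloor>"
      have n: "real n \<le> norm b" "norm b \<le> real n + 1" "n \<ge> 1"
        using ab(3) unfolding n_def by linarith+
      show False
      proof (cases "n \<ge> n0")
        case True
        have "(\<bar>x\<bar> + 1) * norm b \<le> real n * (real n + 1)"
          using n0 n True by (intro mult_mono) auto
        then have "(a, b) \<in> P n"
          using ab a n by (auto simp: P_def Zle_def)
        moreover have "\<bar>x - Re (a / b)\<bar> < 1 / real n ^ N"
        proof -
          have "\<bar>x - Re (a / b)\<bar> \<le> norm (complex_of_real x - a / b)"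
            using abs_Re_le_cmod[of "complex_of_real x - a / b"] by simp
          also have "\<dots> < 1 / norm b ^ N" by (rule close)
          also have "\<dots> \<le> 1 / real n ^ N"
            using n \<open>b \<noteq> 0\<close> by (intro divide_left_mono power_mono) auto
          finally show ?thesis .
        qed
        ultimately have "x \<in> W n"
          by (force simp: W_def dist_real_def abs_minus_commute)
        then show False using contra True by (auto simp: n0_def)
      next
        case False
        then have b: "norm b \<le> real n0" using n by linarith
        then have "(\<bar>x\<bar> + 1) * norm b \<le> (\<bar>x\<bar> + 1) * real n0"
          by (intro mult_left_mono) auto
        then have "(a, b) \<in> Q"
          using a b ab by (auto simp: Q_def Zle_def)
        then show False using M(2)[of "(a, b)"] ab(4) by simp
      qed
    qed
    then have "\<exists>k\<ge>m. x \<in> W (Suc k)" for m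
      by (metis Suc_le_D Suc_le_mono)
    then show "x \<in> limsup (\<lambda>n. W (Suc n))"
      by (auto simp: limsup_INF_SUP)
  qed
  ultimately show ?thesis by (meson null_sets_completion_subset)
qed

theorem theorem7p4:
  fixes \<nu> :: real
  shows "{x::real. bessel_Liouville \<nu> (complex_of_real x)} \<in> null_sets lebesgue"
proof -
  obtain C where C: "\<And>R. R \<ge> 1 \<Longrightarrow> finite {z \<in> bessel_zeros \<nu>. norm z \<le> R} \<and>
      real (card {z \<in> bessel_zeros \<nu>. norm z \<le> R}) \<le> C * R ^ 2"
    using bessel_zeros_polynomial_count by blast
  let ?L = "{x::real. (\<forall>a\<in>bessel_zeros \<nu>. \<forall>b\<in>bessel_zeros \<nu>. complex_of_real x \<noteq> a / b) \<and>
      (\<forall>N::nat. \<exists>a\<in>bessel_zeros \<nu>. \<exists>b\<in>bessel_zeros \<nu>.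
        norm b > 1 \<and> norm (complex_of_real x - a / b) < 1 / norm b ^ N)}"
  have "?L \<in> null_sets lebesgue"
    by (rule null_set_Liouville_quotients[OF C])
  moreover have "{0} \<in> null_sets (lebesgue :: real measure)"
    by (intro null_sets_completionI) (auto intro: null_setsI)
  ultimately have "{0} \<union> ?L \<in> null_sets lebesgue"
    by (rule null_sets.Un[rotated])
  \<comment> \<open>\<open>0\<close> has to be split off because it may be a quotient of zeros although it is never \<open>bessel_rational\<close>.\<close>
  moreover have "{x::real. bessel_Liouville \<nu> (complex_of_real x)} \<subseteq> {0} \<union> ?L"
  proof
    fix x :: real assume "x \<in> {x. bessel_Liouville \<nu> (complex_of_real x)}"
    moreover from this have "complex_of_real x \<noteq> a / b"
      if "x \<noteq> 0" "a \<in> bessel_zeros \<nu>" "b \<in> bessel_zeros \<nu>" for a b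
      \<comment> \<open>For \<open>b = 0\<close> the quotient takes the default value 0, which
        differs from \<open>x\<close>.\<close>
      using that by (cases "b = 0") (auto simp: bessel_Liouville_def bessel_rational_def)
    ultimately show "x \<in> {0} \<union> ?L"
      by (auto simp: bessel_Liouville_def)
  qed
  ultimately show ?thesis
    by (meson null_sets_completion_subset)
qed

end
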